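(* Let $n\ge 1$ be an integer and let $A\colon [0,1]^n\to [0,1]$ be an aggregation function. Then $A$ is compatible if and only if it is a Sugeno integral, i.e., if and only if $A=\mathsf{Su}_m$ for some capacity $m\colon 2^N\to[0,1]$, where $N=\{1,\dots,n\}$.
   Context: Let $N=\{1,\dots,n\}$. On $[0,1]$, $\wedge$ and $\vee$ denote minimum (infimum) and maximum (supremum). An aggregation function on $[0,1]$ is a mapping $A\colon[0,1]^n\to[0,1]$ that is nondecreasing in each coordinate and satisfies $A(0,\dots,0)=0$ and $A(1,\dots,1)=1$. A capacity is a set function $m\colon 2^N\to[0,1]$ with $m(\emptyset)=0$, $m(N)=1$, and $m(E_1)\le m(E_2)$ whenever $E_1\subseteq E_2\subseteq N$. The discrete Sugeno integral with respect to a capacity $m$ is the function $\mathsf{Su}_m\colon[0,1]^n\to[0,1]$ given by $$\mathsf{Su}_m(\mathbf{x})=\bigvee_{t\in[0,1]}\big(t\wedge m(\{i\in N\mid x_i\ge t\})\big),$$ or equivalently by $$\mathsf{Su}_m(\mathbf{x})=\bigvee_{\emptyset\ne I\subseteq N}\Big(m(I)\wedge\bigwedge_{i\in I}x_i\Big).$$ A congruence on the lattice $([0,1],\wedge,\vee)$ is an equivalence relation $C\subseteq[0,1]^2$ such that $(a,b),(c,d)\in C$ implies $(a\vee c,b\vee d)\in C$ and $(a\wedge c,b\wedge d)\in C$. An aggregation function $A\colon[0,1]^n\to[0,1]$ is called compatible if it preserves every congruence $C$ of $([0,1],\wedge,\vee)$, i.e., for every such $C$ and all $\mathbf{x},\mathbf{y}\in[0,1]^n$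 with $(x_1,y_1),\dots,(x_n,y_n)\in C$, also $(A(\mathbf{x}),A(\mathbf{y}))\in C$. *)

theory Defs
  imports Complex_Main "HOL-Library.FuncSet"
begin

(* Points of [0,1]^n are extensional functions on {1..n}, so that two points
   agreeing in all n coordinates are equal as functions. *)
definition unit_cube :: "nat \<Rightarrow> (nat \<Rightarrow> real) set" where
  "unit_cube n = {1..n} \<rightarrow>\<^sub>E {0..1}"

(* Only the values on unit_cube n matter; A is unconstrained elsewhere. *)
definition aggregation_function :: "nat \<Rightarrow> ((nat \<Rightarrow> real) \<Rightarrow> real) \<Rightarrow> bool" where
  "aggregation_function n A \<longleftrightarrow>
     A \<in> unit_cube n \<rightarrow> {0..1} \<and>
     (\<forall>x\<in>unit_cube n. \<forall>i\<in>{1..n}. mono_on {0..1} (\<lambda>t. A (x(i := t)))) \<and>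
     A (\<lambda>i\<in>{1..n}. 0) = 0 \<and>
     A (\<lambda>i\<in>{1..n}. 1) = 1"

definition capacity :: "nat \<Rightarrow> (nat set \<Rightarrow> real) \<Rightarrow> bool" where
  "capacity n m \<longleftrightarrow>
     m \<in> Pow {1..n} \<rightarrow> {0..1} \<and>
     m {} = 0 \<and>
     m {1..n} = 1 \<and>
     mono_on (Pow {1..n}) m"

(* For a capacity m, the set under the supremum is nonempty and contained in
   [0,1], so the supremum in the reals is the one in [0,1]. *)
definition sugeno_integral :: "nat \<Rightarrow> (nat set \<Rightarrow> real) \<Rightarrow> (nat \<Rightarrow> real) \<Rightarrow> real" where
  "sugeno_integral n m x = (SUP t\<in>{0..1}. min t (m {i\<in>{1..n}. x i \<ge> t}))"

definition lattice_congruence :: "(real \<times> real) set \<Rightarrow> bool" where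
  "lattice_congruence C \<longleftrightarrow>
     equiv {0..1} C \<and>
     (\<forall>a b c d. (a, b) \<in> C \<and> (c, d) \<in> C \<longrightarrow>
        (max a c, max b d) \<in> C \<and> (min a c, min b d) \<in> C)"

definition compatible :: "nat \<Rightarrow> ((nat \<Rightarrow> real) \<Rightarrow> real) \<Rightarrow> bool" where
  "compatible n A \<longleftrightarrow>
     (\<forall>C. lattice_congruence C \<longrightarrow>
        (\<forall>x\<in>unit_cube n. \<forall>y\<in>unit_cube n.
           (\<forall>i\<in>{1..n}. (x i, y i) \<in> C) \<longrightarrow> (A x, A y) \<in> C))"

end

theory Submission
  imports Defs
begin

(* For 0 < t the partition of [0,1] into [0,t) and [t,1] is a congruence, and it identifies x
   with the indicator of the level set E_t = {i. x i >= t}. Hence, with m I the value of a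
   compatible A at the indicator of I, one has t <= A x iff t <= m E_t, and this determines A x
   as the Sugeno integral. Conversely, the Sugeno integral is a lattice polynomial in x with
   constants m I, and lattice polynomials preserve congruences. *)

definition cube_indicator :: "nat \<Rightarrow> nat set \<Rightarrow> nat \<Rightarrow> real" where
  "cube_indicator n I = (\<lambda>i\<in>{1..n}. if i \<in> I then 1 else 0)"

lemma cube_indicator_in_unit_cube: "cube_indicator n I \<in> unit_cube n"
  by (auto simp: cube_indicator_def unit_cube_def)

lemma cube_indicator_insert:
  "k \<in> {1..n} \<Longrightarrow> cube_indicator n (insert k I) = (cube_indicator n I)(k := 1)"
  by (auto simp: cube_indicator_def)

text \<open>Adding one index to \<open>I\<close> raises one coordinate from 0 or 1 to 1, so
  coordinatewise monotonicity applies; adding indices one at a time covers every inclusion.\<close>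

lemma capacity_cube_indicator:
  assumes "aggregation_function n A"
  shows "capacity n (\<lambda>I. A (cube_indicator n I))"
proof -
  let ?m = "\<lambda>I. A (cube_indicator n I)"
  have step: "?m I \<le> ?m (insert k I)" if "k \<in> {1..n}" for I k
  proof -
    let ?x = "cube_indicator n I"
    have mono: "mono_on {0..1} (\<lambda>t. A (?x(k := t)))"
      using assms that cube_indicator_in_unit_cube by (auto simp: aggregation_function_def)
    have "?x k \<in> {0..1}"
      using that by (auto simp: cube_indicator_def)
    then have "A (?x(k := ?x k)) \<le> A (?x(k := 1))"
      by (intro mono_onD[OF mono]) auto
    then show ?thesis
      using that by (simp add: cube_indicator_insert)
  qed
  have union: "?m I \<le> ?m (K \<union> I)" if "finite K" "K \<subseteq> {1..n}" for I K
    using that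
  proof (induction K rule: finite_induct)
    case (insert k K)
    then show ?case
      using step[of k "K \<union> I"] by fastforce
  qed simp
  have "mono_on (Pow {1..n}) ?m"
  proof (rule mono_onI)
    fix I J assume "I \<in> Pow {1..n}" "J \<in> Pow {1..n}" "I \<le> J"
    moreover from this have "finite J"
      by (meson PowD finite_atLeastAtMost finite_subset)
    ultimately show "?m I \<le> ?m J"
      using union[of J I] by (auto simp: sup_absorb1)
  qed
  moreover have "cube_indicator n {} = (\<lambda>i\<in>{1..n}. 0)" "cube_indicator n {1..n} = (\<lambda>i\<in>{1..n}. 1)"
    by (auto simp: cube_indicator_def)
  ultimately show ?thesis
    using assms cube_indicator_in_unit_cube by (auto simp: capacity_def aggregation_function_def)
qed

text \<open>This is the kernel of the test \<open>t \<le> a\<close>, which turns \<open>max\<close>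
  into disjunction and \<open>min\<close> into conjunction.\<close>

lemma lattice_congruence_threshold:
  "lattice_congruence {(a, b). a \<in> {0..1} \<and> b \<in> {0..1} \<and> (t \<le> a \<longleftrightarrow> t \<le> b)}"
  unfolding lattice_congruence_def
  by (auto simp: equiv_def refl_on_def sym_def trans_def)

lemma compatible_threshold:
  assumes "compatible n A" "x \<in> unit_cube n" and t: "0 < t" "t \<le> 1"
  shows "t \<le> A x \<longleftrightarrow> t \<le> A (cube_indicator n {i\<in>{1..n}. t \<le> x i})"
proof -
  let ?C = "{(a, b). a \<in> {0..1} \<and> b \<in> {0..1} \<and> (t \<le> a \<longleftrightarrow> t \<le> b)}"
  let ?y = "cube_indicator n {i\<in>{1..n}. t \<le> x i}"
  \<comment> \<open>\<open>0 < t\<close> puts the indicator value 0 in the lower class, and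
    \<open>t \<le> 1\<close> puts the value 1 in the upper one.\<close>
  have "\<forall>i\<in>{1..n}. (x i, ?y i) \<in> ?C"
    using assms by (auto simp: unit_cube_def cube_indicator_def PiE_iff)
  then have "(A x, A ?y) \<in> ?C"
    using assms(1,2) cube_indicator_in_unit_cube lattice_congruence_threshold[of t]
    unfolding compatible_def by blast
  then show ?thesis
    by auto
qed

lemma bdd_above_sugeno: "bdd_above ((\<lambda>t. min t (f t)) ` {0..1::real})"
  by (rule bdd_aboveI[of _ 1]) auto

text \<open>The supremum is attained at \<open>t = a\<close>, where the hypothesis makes the term
  equal to \<open>a\<close>.\<close>

lemma sugeno_integral_eqI:
  assumes m: "capacity n m" and a: "a \<in> {0..1}"
    and threshold: "\<And>t. 0 < t \<Longrightarrow> t \<le> 1 \<Longrightarrow> t \<le> a \<longleftrightarrow> t \<le> m {i\<in>{1..n}. t \<le> x i}"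
  shows "sugeno_integral n m x = a"
  unfolding sugeno_integral_def
proof (rule antisym)
  have range: "m I \<in> {0..1}" if "I \<subseteq> {1..n}" for I
    using m that by (auto simp: capacity_def)
  show "(SUP t\<in>{0..1}. min t (m {i \<in> {1..n}. t \<le> x i})) \<le> a"
  proof (rule cSUP_least)
    fix t :: real assume t: "t \<in> {0..1}"
    \<comment> \<open>The hypothesis is applied at the value \<open>s\<close> of the term instead of
      at \<open>t\<close>: since \<open>s \<le> t\<close>, the level set can only grow, so its
      capacity is still at least \<open>s\<close>.\<close>
    define s where "s = min t (m {i \<in> {1..n}. t \<le> x i})"
    have "m {i \<in> {1..n}. t \<le> x i} \<le> m {i \<in> {1..n}. s \<le> x i}"
      using m by (intro mono_onD[of "Pow {1..n}" m]) (auto simp: capacity_def s_def)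
    then have "s \<le> m {i \<in> {1..n}. s \<le> x i}"
      by (simp add: s_def)
    then have "s \<le> a"
      using threshold[of s] a t by (cases "0 < s") (auto simp: s_def)
    then show "min t (m {i \<in> {1..n}. t \<le> x i}) \<le> a"
      by (simp add: s_def)
  qed simp
  have "m {i \<in> {1..n}. a \<le> x i} \<in> {0..1}"
    by (rule range) auto
  then have "a \<le> min a (m {i \<in> {1..n}. a \<le> x i})"
    using threshold[of a] a by (cases "0 < a") auto
  then show "a \<le> (SUP t\<in>{0..1}. min t (m {i \<in> {1..n}. t \<le> x i}))"
    using a by (intro cSUP_upper2[OF bdd_above_sugeno])
qed

(* Including m I in the minimum makes the term for I = {} equal to m {} = 0. *)
lemma sugeno_integral_eq_Max_Min:
  assumes m: "capacity n m" and x: "x \<in> unit_cube n"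
  shows "sugeno_integral n m x = Max ((\<lambda>I. Min (insert (m I) (x ` I))) ` Pow {1..n})"
  unfolding sugeno_integral_def
proof (rule antisym)
  let ?g = "\<lambda>I. Min (insert (m I) (x ` I))"
  have fin: "finite I" if "I \<subseteq> {1..n}" for I
    using that finite_subset by blast
  show "(SUP t\<in>{0..1}. min t (m {i \<in> {1..n}. t \<le> x i})) \<le> Max (?g ` Pow {1..n})"
  proof (rule cSUP_least)
    fix t :: real
    let ?E = "{i \<in> {1..n}. t \<le> x i}"
    \<comment> \<open>Every coordinate indexed by the level set is at least
      \<open>t\<close>.\<close>
    have "min t (m ?E) \<le> ?g ?E"
      by auto
    also have "\<dots> \<le> Max (?g ` Pow {1..n})"
      by (intro Max_ge) auto
    finally show "min t (m ?E) \<le> Max (?g ` Pow {1..n})" .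
  qed simp
  have "?g I \<le> (SUP t\<in>{0..1}. min t (m {i \<in> {1..n}. t \<le> x i}))" if I: "I \<subseteq> {1..n}" for I
  proof -
    have le: "?g I \<le> m I" "\<And>i. i \<in> I \<Longrightarrow> ?g I \<le> x i"
      using fin[OF I] by auto
    have mI: "m I \<in> {0..1}"
      using m I by (auto simp: capacity_def)
    have "0 \<le> x i" if "i \<in> I" for i
      using x I that by (auto simp: unit_cube_def PiE_iff)
    then have "0 \<le> ?g I"
      using mI fin[OF I] by auto
    then have g: "?g I \<in> {0..1}"
      using le(1) mI unfolding atLeastAtMost_iff by linarith
    \<comment> \<open>With \<open>?g I\<close> as the threshold, the level set contains
      \<open>I\<close>, so the term of the supremum there is \<open>?g I\<close> itself.\<close>
    have "m I \<le> m {i \<in> {1..n}. ?g I \<le> x i}"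
      using m I le(2) by (intro mono_onD[of "Pow {1..n}" m]) (auto simp: capacity_def)
    then show ?thesis
      using g le(1) by (intro cSUP_upper2[OF bdd_above_sugeno, of "?g I"]) auto
  qed
  then show "Max (?g ` Pow {1..n}) \<le> (SUP t\<in>{0..1}. min t (m {i \<in> {1..n}. t \<le> x i}))"
    by (intro Max.boundedI) auto
qed

lemma lattice_congruence_Max:
  assumes "lattice_congruence C" "finite S" "S \<noteq> {}" "\<And>i. i \<in> S \<Longrightarrow> (f i, g i) \<in> C"
  shows "(Max (f ` S), Max (g ` S)) \<in> C"
  using assms(2-)
  by (induction S rule: finite_ne_induct) (use assms(1) in \<open>auto simp: lattice_congruence_def\<close>)

text \<open>The separate pair \<open>(a, b)\<close> carries the constant \<open>m I\<close> and
  admits an empty \<open>S\<close>, as needed for the term of the empty set.\<close>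

lemma lattice_congruence_Min_insert:
  assumes "lattice_congruence C" "finite S" "(a, b) \<in> C" "\<And>i. i \<in> S \<Longrightarrow> (f i, g i) \<in> C"
  shows "(Min (insert a (f ` S)), Min (insert b (g ` S))) \<in> C"
  using assms(2,4)
proof (induction S rule: finite_induct)
  case empty
  then show ?case
    using assms(3) by simp
next
  case (insert i S)
  have "Min (insert c (h ` insert i S)) = min (h i) (Min (insert c (h ` S)))" for c and h :: "'a \<Rightarrow> real"
    using insert.hyps(1) by (simp add: insert_commute[of c])
  then show ?case
    using assms(1) insert unfolding lattice_congruence_def by simp
qed

text \<open>The finite max-min form is essential: a congruence respects binary \<open>min\<close>
  and \<open>max\<close>, hence finite ones, but not arbitrary suprema.\<close>

lemma compatible_sugeno_integral:
  assumes m: "capacity n m"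
  shows "compatible n (sugeno_integral n m)"
  unfolding compatible_def
proof (intro allI impI ballI)
  fix C x y
  assume C: "lattice_congruence C" and xy: "x \<in> unit_cube n" "y \<in> unit_cube n"
    and rel: "\<forall>i\<in>{1..n}. (x i, y i) \<in> C"
  have "(Min (insert (m I) (x ` I)), Min (insert (m I) (y ` I))) \<in> C" if I: "I \<in> Pow {1..n}" for I
  proof (rule lattice_congruence_Min_insert[OF C])
    show "finite I"
      using I finite_subset by blast
    have "m I \<in> {0..1}"
      using m I by (auto simp: capacity_def)
    \<comment> \<open>Constants from [0,1] are harmless because a congruence is reflexive
      there.\<close>
    then show "(m I, m I) \<in> C"
      using C by (auto simp: lattice_congruence_def equiv_def refl_on_def)
  qed (use rel I in auto)
  then show "(sugeno_integral n m x, sugeno_integral n m y) \<in> C"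
    unfolding sugeno_integral_eq_Max_Min[OF m xy(1)] sugeno_integral_eq_Max_Min[OF m xy(2)]
    by (intro lattice_congruence_Max[OF C]) auto
qed

theorem theorem2p4:
  fixes n :: nat and A :: "(nat \<Rightarrow> real) \<Rightarrow> real"
  assumes "n \<ge> 1"
    and "aggregation_function n A"
  shows "compatible n A \<longleftrightarrow>
    (\<exists>m. capacity n m \<and> (\<forall>x\<in>unit_cube n. A x = sugeno_integral n m x))"
proof
  assume A: "compatible n A"
  let ?m = "\<lambda>I. A (cube_indicator n I)"
  have m: "capacity n ?m"
    by (rule capacity_cube_indicator[OF assms(2)])
  moreover have "A x = sugeno_integral n ?m x" if "x \<in> unit_cube n" for x
  proof (rule sugeno_integral_eqI[symmetric, OF m])
    show "A x \<in> {0..1}"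
      using assms(2) that by (auto simp: aggregation_function_def)
  qed (rule compatible_threshold[OF A that])
  ultimately show "\<exists>m. capacity n m \<and> (\<forall>x\<in>unit_cube n. A x = sugeno_integral n m x)"
    by blast
next
  assume "\<exists>m. capacity n m \<and> (\<forall>x\<in>unit_cube n. A x = sugeno_integral n m x)"
  then obtain m where "capacity n m" "\<forall>x\<in>unit_cube n. A x = sugeno_integral n m x"
    by blast
  then show "compatible n A"
    using compatible_sugeno_integral unfolding compatible_def by simp
qed

end
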